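(* Let $\mathcal{H}$ be a real Hilbert space, let $A:\mathcal{H}\rightrightarrows\mathcal{H}$ be a maximally monotone operator, and let $S:=\{x\in\mathcal{H}: 0\in Ax\}\neq\varnothing$. Assume further that $A^{-1}$ is R-continuous at $0$ with the modulus function $\rho$. Let $\gamma>0$, let $\epsilon,\delta>0$ be fixed parameters, put $\widetilde{A}:=A+\epsilon I$, and let $(x_k)$ be the sequence generated by the Inexact Proximal Point Algorithm $$x_{k+1}=(I+\gamma\widetilde{A})^{-1}x_k+y_{k+1},\qquad x_0\in\mathcal{H},\quad k=0,1,2,\ldots,$$ where the errors satisfy $\|y_{k+1}\|\le\delta$ for all $k\ge 0$. Then $$\limsup_{k\to\infty} d(x_k,S)\le \delta\,(1+\gamma^{-1}\epsilon^{-1})+\rho(\epsilon a),$$ where $a:=\|\widetilde{x}\|$ and $\widetilde{x}$ is the minimal norm element of $S$. Moreover, by choosing $\delta=\epsilon^2$, one gets $$\limsup_{k\to\infty} d(x_k,S)\le \epsilon^2+\gamma^{-1}\epsilon+\rho(\epsilon a)\to 0\quad\text{as }\epsilon\to 0.$$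
   Context: $I$ is the identity operator on $\mathcal{H}$ and $d(x,S)=\inf_{s\in S}\|x-s\|$. For a set-valued operator $F:\mathcal{H}\rightrightarrows\mathcal{H}$, $F^{-1}(y)=\{x\in\mathcal{H}: y\in F(x)\}$ and $\operatorname{dom}F=\{x: F(x)\ne\varnothing\}$. $F$ is monotone if $\langle x^*-y^*,x-y\rangle\ge 0$ whenever $x^*\in F(x)$, $y^*\in F(y)$, and maximally monotone if it is monotone and its graph is not properly contained in the graph of another monotone operator. For maximally monotone $F$ the resolvent $(I+F)^{-1}$ is single-valued and defined on all of $\mathcal{H}$, so the iteration is well defined. R-continuity: a set-valued mapping $\mathcal{A}:\mathcal{H}\rightrightarrows\mathcal{H}$ is R-continuous at $\bar{x}\in\operatorname{dom}\mathcal{A}$ with modulus function $\rho$ if there is a number $\sigma>0$ (the radius, possibly $\infty$) such that, with $\rho:[0,\infty)\to[0,\infty)$ an increasing function satisfying $\lim_{r\to 0^+}\rho(r)=\rho(0)=0$, for every $x$ in the ball of center $\bar{x}$ and radius $\sigma$ and every $y\in\mathcal{A}(x)$ there exists $\bar{y}\in\mathcal{A}(\bar{x})$ with $\|y-\bar{y}\|\le\rho(\|x-\bar{x}\|)$.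
   Formalization: Both bounds are stated under the added condition εa ≤ σ, where σ is the radius of R-continuity of A⁻¹ at 0 (vacuous if σ = ∞, true for all small ε); without it the claim fails, e.g. for A = ∂|x−1| on ℝ, ρ(r) = r/10, ε = 2. *)

theory Defs
  imports "HOL-Analysis.Analysis"
begin

definition graph_op :: "('a \<Rightarrow> 'b set) \<Rightarrow> ('a \<times> 'b) set" where
  "graph_op F = {(x, u). u \<in> F x}"

definition dom_op :: "('a \<Rightarrow> 'b set) \<Rightarrow> 'a set" where
  "dom_op F = {x. F x \<noteq> {}}"

definition inverse_op :: "('a \<Rightarrow> 'b set) \<Rightarrow> 'b \<Rightarrow> 'a set" where
  "inverse_op F y = {x. y \<in> F x}"

definition id_op :: "'a \<Rightarrow> 'a set" where
  "id_op x = {x}"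

definition plus_op :: "('a \<Rightarrow> 'b::plus set) \<Rightarrow> ('a \<Rightarrow> 'b set) \<Rightarrow> 'a \<Rightarrow> 'b set" where
  "plus_op F G x = {u + v | u v. u \<in> F x \<and> v \<in> G x}"

definition scale_op :: "real \<Rightarrow> ('a \<Rightarrow> 'b::real_vector set) \<Rightarrow> 'a \<Rightarrow> 'b set" where
  "scale_op c F x = {c *\<^sub>R u | u. u \<in> F x}"

definition monotone_op :: "('a::real_inner \<Rightarrow> 'a set) \<Rightarrow> bool" where
  "monotone_op F \<longleftrightarrow>
     (\<forall>x y. \<forall>u\<in>F x. \<forall>v\<in>F y. inner (u - v) (x - y) \<ge> 0)"

definition maximally_monotone :: "('a::real_inner \<Rightarrow> 'a set) \<Rightarrow> bool" where
  "maximally_monotone F \<longleftrightarrow>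
     monotone_op F \<and> \<not> (\<exists>G. monotone_op G \<and> graph_op F \<subset> graph_op G)"

text \<open>The resolvent \<open>(I + F)\<^sup>-\<^sup>1\<close> as a function. It is meant for maximally monotone \<open>F\<close>,
  where the set \<open>inverse_op (plus_op id_op F) x\<close> is a singleton for every \<open>x\<close>.\<close>

definition resolvent :: "('a::real_inner \<Rightarrow> 'a set) \<Rightarrow> 'a \<Rightarrow> 'a" where
  "resolvent F x = (THE z. z \<in> inverse_op (plus_op id_op F) x)"

text \<open>Only the values of \<open>\<rho>\<close> on \<open>[0, \<infinity>)\<close> matter; ``increasing'' is read non-strictly.\<close>

definition modulus_function :: "(real \<Rightarrow> real) \<Rightarrow> bool" where
  "modulus_function \<rho> \<longleftrightarrow>
     (\<forall>r\<ge>0. \<rho> r \<ge> 0) \<and> mono_on {0..} \<rho> \<and> \<rho> 0 = 0 \<and> (\<rho> \<longlongrightarrow> 0) (at_right 0)"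

text \<open>R-continuity at \<open>xb\<close> with modulus \<open>\<rho>\<close> and radius \<open>\<sigma> \<in> (0, \<infinity>]\<close>. The ball is open, the weaker
  requirement: R-continuity on the closed ball of radius \<open>\<sigma>\<close> implies it.\<close>

definition R_continuous_radius ::
    "ereal \<Rightarrow> ('a::real_normed_vector \<Rightarrow> 'b::real_normed_vector set) \<Rightarrow> 'a \<Rightarrow> (real \<Rightarrow> real) \<Rightarrow> bool" where
  "R_continuous_radius \<sigma> F xb \<rho> \<longleftrightarrow>
     xb \<in> dom_op F \<and> \<sigma> > 0 \<and> modulus_function \<rho> \<and>
     (\<forall>x. ereal (norm (x - xb)) < \<sigma> \<longrightarrow>
        (\<forall>y\<in>F x. \<exists>yb\<in>F xb. norm (y - yb) \<le> \<rho> (norm (x - xb))))"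

definition zeros_op :: "('a \<Rightarrow> 'b::zero set) \<Rightarrow> 'a set" where
  "zeros_op F = {x. 0 \<in> F x}"

definition min_norm_element :: "'a::real_normed_vector set \<Rightarrow> 'a" where
  "min_norm_element S = (ARG_MIN norm x. x \<in> S)"

definition regularized_op :: "real \<Rightarrow> ('a::real_vector \<Rightarrow> 'a set) \<Rightarrow> 'a \<Rightarrow> 'a set" where
  "regularized_op \<epsilon> A = plus_op A (scale_op \<epsilon> id_op)"

text \<open>\<open>y 0\<close> plays no role: the errors are \<open>y 1, y 2, \<dots>\<close>.\<close>

definition inexact_ppa ::
    "('a::real_inner \<Rightarrow> 'a set) \<Rightarrow> real \<Rightarrow> real \<Rightarrow> real \<Rightarrow> (nat \<Rightarrow> 'a) \<Rightarrow> (nat \<Rightarrow> 'a) \<Rightarrow> bool" where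
  "inexact_ppa A \<gamma> \<epsilon> \<delta> x y \<longleftrightarrow>
     (\<forall>k. x (Suc k) = resolvent (scale_op \<gamma> (regularized_op \<epsilon> A)) (x k) + y (Suc k)) \<and>
     (\<forall>k. norm (y (Suc k)) \<le> \<delta>)"

end

theory Submission
  imports Defs
begin

text \<open>The resolvent of \<open>\<gamma>(A + \<epsilon>I)\<close> is a contraction with factor \<open>q = 1 / (1 + \<gamma>\<epsilon>)\<close>, whose fixed point \<open>p\<close> is
  the solution of \<open>-\<epsilon>p \<in> A p\<close>. Hence errors of size \<open>\<delta>\<close> accumulate to at most
  \<open>\<delta> / (1 - q) = \<delta>(1 + 1 / (\<gamma>\<epsilon>))\<close> in the distance to \<open>p\<close>. Monotonicity gives \<open>|p| \<le> a\<close>, so R-continuity of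
  the inverse of \<open>A\<close> at \<open>0\<close> places \<open>p\<close> within \<open>\<rho>(\<epsilon>a)\<close> of a zero of \<open>A\<close>.\<close>

section \<open>Minty's surjectivity theorem by convex duality\<close>

text \<open>The parallelogram law makes the first components of a minimising sequence Cauchy. The
  second component enters the objective linearly, so it converges along with the objective
  values.\<close>

lemma quadratic_attains_inf:
  fixes K :: "('a::{real_inner, complete_space} \<times> real) set"
  assumes "closed K" "convex K" "K \<noteq> {}"
    and lower: "\<And>c d. (c, d) \<in> K \<Longrightarrow> b \<le> (norm c)\<^sup>2 / 4 + d"
  obtains C D where "(C, D) \<in> K"
    "\<And>c d. (c, d) \<in> K \<Longrightarrow> (norm C)\<^sup>2 / 4 + D \<le> (norm c)\<^sup>2 / 4 + d"
proof -
  define h :: "'a \<times> real \<Rightarrow> real" where "h p = (norm (fst p))\<^sup>2 / 4 + snd p" for p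
  define m where "m = Inf (h ` K)"
  have bdd: "bdd_below (h ` K)"
    using lower by (intro bdd_belowI[of _ b]) (auto simp: h_def)
  have m_le: "m \<le> h p" if "p \<in> K" for p
    unfolding m_def using bdd that by (intro cInf_lower) auto
  have "\<exists>p\<in>K. h p < m + 1 / real (Suc n)" for n
    using cInf_lessD[of "h ` K" "m + 1 / real (Suc n)"] \<open>K \<noteq> {}\<close> by (auto simp: m_def)
  then obtain p where p: "\<And>n. p n \<in> K" "\<And>n. h (p n) < m + 1 / real (Suc n)"
    by metis
  have mid: "(norm (fst u - fst v))\<^sup>2 \<le> 8 * (h u + h v - 2 * m)" if "u \<in> K" "v \<in> K" for u v
  proof -
    let ?w = "(1/2) *\<^sub>R u + (1/2) *\<^sub>R v"
    have "?w \<in> K"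
      using \<open>convex K\<close> that by (intro convexD) auto
    then have "m \<le> h ?w"
      by (rule m_le)
    also have "h ?w = (h u + h v) / 2 - (norm (fst u - fst v))\<^sup>2 / 16"
      by (simp add: h_def power2_norm_eq_inner inner_add_left inner_add_right inner_diff_left
          inner_diff_right inner_commute field_simps)
    finally show ?thesis by argo
  qed
  have "Cauchy (\<lambda>n. fst (p n))"
  proof (rule metric_CauchyI)
    fix e :: real assume "e > 0"
    \<comment> \<open>Both objective values exceed \<open>m\<close> by less than
      \<open>1 / (N + 1)\<close>, so \<open>mid\<close> bounds the squared distance by
      \<open>8 * 2 / (N + 1)\<close>.\<close>
    obtain N where N: "16 / e\<^sup>2 < real N"
      using reals_Archimedean2 by blast
    have "dist (fst (p i)) (fst (p j)) < e" if "i \<ge> N" "j \<ge> N" for i j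
    proof -
      have s: "1 / real (Suc k) \<le> 1 / real (Suc N)" if "k \<ge> N" for k
        using that by (intro divide_left_mono) auto
      have "(norm (fst (p i) - fst (p j)))\<^sup>2 \<le> 8 * (h (p i) + h (p j) - 2 * m)"
        using mid p(1) by blast
      also have "\<dots> \<le> 16 * (1 / real (Suc N))"
        using p(2)[of i] p(2)[of j] s[OF that(1)] s[OF that(2)] by argo
      also have "\<dots> < e\<^sup>2"
        using N \<open>e > 0\<close> by (simp add: field_simps add_strict_increasing)
      finally show ?thesis
        using \<open>e > 0\<close> by (simp add: dist_norm power2_less_imp_less)
    qed
    then show "\<exists>N. \<forall>i\<ge>N. \<forall>j\<ge>N. dist (fst (p i)) (fst (p j)) < e" by blast
  qed
  then obtain C where C: "(\<lambda>n. fst (p n)) \<longlonglongrightarrow> C"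
    using Cauchy_convergent_iff convergent_def by blast
  have hm: "(\<lambda>n. h (p n)) \<longlonglongrightarrow> m"
  proof (rule tendsto_sandwich[of "\<lambda>_. m" _ _ "\<lambda>n. m + 1 / real (Suc n)"])
    show "(\<lambda>n. m + 1 / real (Suc n)) \<longlonglongrightarrow> m"
      using tendsto_add[OF tendsto_const LIMSEQ_inverse_real_of_nat, of m]
      by (simp add: inverse_eq_divide)
    show "\<forall>\<^sub>F n in sequentially. m \<le> h (p n)"
      using m_le p(1) by (simp add: always_eventually)
    show "\<forall>\<^sub>F n in sequentially. h (p n) \<le> m + 1 / real (Suc n)"
      using p(2) by (intro always_eventually) (auto intro: less_imp_le)
  qed simp
  define D where "D = m - (norm C)\<^sup>2 / 4"
  have "(\<lambda>n. h (p n) - (norm (fst (p n)))\<^sup>2 / 4) \<longlonglongrightarrow> D"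
    unfolding D_def by (intro tendsto_intros hm C) auto
  then have "(\<lambda>n. snd (p n)) \<longlonglongrightarrow> D"
    by (simp add: h_def)
  from tendsto_Pair[OF C this] have "(C, D) \<in> K"
    using \<open>closed K\<close> p(1) by (auto intro: closed_sequentially)
  moreover have "(norm C)\<^sup>2 / 4 + D \<le> (norm c)\<^sup>2 / 4 + d" if "(c, d) \<in> K" for c d
    using m_le[OF that] by (simp add: D_def h_def)
  ultimately show ?thesis by (rule that)
qed

text \<open>For a convex combination of generators, the gap \<open>D - inner V Y\<close> is half the
  weighted double sum of the terms \<open>inner (v - v') (y - y')\<close>. Instead of expanding
  sums, the proof uses that monotonicity is affine in each of the two lifted points and extends it
  to the hull one point at a time.\<close>

lemma monotone_convex_hull:
  fixes G :: "('a::real_inner \<times> 'a) set"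
  assumes mono: "\<And>y v y' v'. (y, v) \<in> G \<Longrightarrow> (y', v') \<in> G \<Longrightarrow> inner (v - v') (y - y') \<ge> 0"
    and Q: "(Y, V, D) \<in> convex hull ((\<lambda>(y, v). (y, v, inner v y)) ` G)"
  shows "inner V Y \<le> D"
proof -
  let ?T = "(\<lambda>(y, v). (y, v, inner v y)) ` G"
  \<comment> \<open>Membership of \<open>(y', v', d')\<close> means
    \<open>inner V y' + inner Y v' \<le> D + d'\<close>. This relation is symmetric in the two
    points, and between generators it is monotonicity.\<close>
  let ?L = "\<lambda>Y V D. {q :: 'a \<times> 'a \<times> real. inner (V, Y, -1) q \<le> D}"
  have hull: "convex hull ?T \<subseteq> ?L Y V D" if "?T \<subseteq> ?L Y V D" for Y V D
    using that by (intro hull_minimal convex_halfspace_le)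
  have gen: "(Y, V, D) \<in> ?L y v (inner v y)" if "(y, v) \<in> G" for y v
  proof -
    have "?T \<subseteq> ?L y v (inner v y)"
    proof clarsimp
      fix y' v' assume "(y', v') \<in> G"
      with mono[OF that this]
      show "inner v y' + (inner y v' - inner v' y') \<le> inner v y"
        by (simp add: inner_diff_left inner_diff_right inner_commute)
    qed
    from hull[OF this] show ?thesis using Q by blast
  qed
  \<comment> \<open>By symmetry the hull point itself now defines the half-space; testing it against
    itself gives \<open>2 * inner V Y \<le> 2 * D\<close>.\<close>
  have "?T \<subseteq> ?L Y V D"
    using gen by (fastforce simp: inner_commute)
  from hull[OF this] Q have "inner (V, Y, -1) (Y, V, D) \<le> D"
    by blast
  then show ?thesis
    by (simp add: inner_commute)
qed

text \<open>Minty's surjectivity theorem in the form of Debrunner and Flor. The requirement on \<open>x\<close> reads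
  \<open>|x|\<^sup>2 - \<langle>x, y - v\<rangle> - \<langle>v, y\<rangle> \<le> 0\<close>; the dual of minimising the supremum of the left-hand sides is to
  minimise \<open>|c|\<^sup>2 / 4 + d\<close> over the closed convex hull of the points \<open>(y - v, \<langle>v, y\<rangle>)\<close>. The dual
  minimum is attained without any weak compactness, and its first-order condition says that
  \<open>x = C / 2\<close> works.\<close>

lemma debrunner_flor:
  fixes G :: "('a::{real_inner, complete_space} \<times> 'a) set"
  assumes mono: "\<And>y v y' v'. (y, v) \<in> G \<Longrightarrow> (y', v') \<in> G \<Longrightarrow> inner (v - v') (y - y') \<ge> 0"
  obtains x where "\<And>y v. (y, v) \<in> G \<Longrightarrow> inner (v + x) (y - x) \<ge> 0"
proof (cases "G = {}")
  case False
  define T where "T = convex hull ((\<lambda>(y, v). (y, v, inner v y)) ` G)"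
  define f :: "'a \<times> 'a \<times> real \<Rightarrow> 'a \<times> real" where "f = (\<lambda>(y, v, d). (y - v, d))"
  define K where "K = closure (f ` T)"
  have "linear f"
    by (rule linearI) (auto simp: f_def algebra_simps)
  then have cv: "convex K"
    unfolding K_def T_def by (intro convex_closure convex_linear_image) auto
  have ne: "K \<noteq> {}"
    using False by (simp add: K_def T_def)
  \<comment> \<open>The dual objective is nonnegative: since \<open>inner V Y \<le> D\<close>, it is
    at least \<open>(norm (Y + V))\<^sup>2 / 4\<close>.\<close>
  have "f ` T \<subseteq> {p. 0 \<le> (norm (fst p))\<^sup>2 / 4 + snd p}"
  proof
    fix p assume "p \<in> f ` T"
    then obtain Y V D where T: "(Y, V, D) \<in> T" and p: "p = (Y - V, D)"
      by (auto simp: f_def)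
    have "inner V Y \<le> D"
      using monotone_convex_hull[OF mono] T unfolding T_def by blast
    moreover have "(norm (Y - V))\<^sup>2 / 4 + inner V Y = (norm (Y + V))\<^sup>2 / 4"
      by (simp add: power2_norm_eq_inner inner_add_left inner_add_right inner_diff_left
          inner_diff_right inner_commute field_simps)
    moreover have "(norm (Y + V))\<^sup>2 / 4 \<ge> 0"
      by simp
    ultimately have "0 \<le> (norm (Y - V))\<^sup>2 / 4 + D"
      by linarith
    then show "p \<in> {p. 0 \<le> (norm (fst p))\<^sup>2 / 4 + snd p}"
      by (simp add: p)
  qed
  then have "K \<subseteq> {p. 0 \<le> (norm (fst p))\<^sup>2 / 4 + snd p}"
    unfolding K_def by (intro closure_minimal closed_Collect_le continuous_intros) auto
  then have nonneg: "0 \<le> (norm c)\<^sup>2 / 4 + d" if "(c, d) \<in> K" for c d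
    using that by auto
  obtain C D where CD: "(C, D) \<in> K"
    and le: "\<And>c d. (c, d) \<in> K \<Longrightarrow> (norm C)\<^sup>2 / 4 + D \<le> (norm c)\<^sup>2 / 4 + d"
    using quadratic_attains_inf[of K 0] cv ne nonneg unfolding K_def by auto
  show ?thesis
  proof (rule that)
    fix y v assume yv: "(y, v) \<in> G"
    define c where "c = y - v"
    define d where "d = inner v y"
    have "f (y, v, d) \<in> f ` T"
      unfolding T_def d_def using yv by (intro imageI hull_inc) force
    then have cd: "(c, d) \<in> K"
      unfolding K_def c_def using closure_subset[of "f ` T"] by (force simp: f_def)
    \<comment> \<open>Moving from \<open>(C, D)\<close> towards \<open>(c, d)\<close> changes the
      objective by \<open>t * (s + t * q)\<close>, so \<open>s\<close> is the one-sided derivative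
      at the minimiser.\<close>
    define s where "s = inner C (c - C) / 2 + d - D"
    define q where "q = (norm (c - C))\<^sup>2 / 4"
    have *: "0 \<le> s + t * q" if "0 < t" "t \<le> 1" for t
    proof -
      have "(1 - t) *\<^sub>R (C, D) + t *\<^sub>R (c, d) \<in> K"
        using cv CD cd that by (intro convexD) auto
      then have "((1 - t) *\<^sub>R C + t *\<^sub>R c, (1 - t) * D + t * d) \<in> K"
        by simp
      moreover have "(1 - t) *\<^sub>R C + t *\<^sub>R c = C + t *\<^sub>R (c - C)"
        by (simp add: algebra_simps)
      ultimately have "(norm C)\<^sup>2 / 4 + D \<le> (norm (C + t *\<^sub>R (c - C)))\<^sup>2 / 4 + ((1 - t) * D + t * d)"
        using le by simp
      also have "(norm (C + t *\<^sub>R (c - C)))\<^sup>2 = (norm C)\<^sup>2 + 2 * t * inner C (c - C) + t\<^sup>2 * (norm (c - C))\<^sup>2"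
        unfolding power2_norm_eq_inner
        by (simp add: inner_add_left inner_add_right inner_commute power2_eq_square)
      finally have "0 \<le> t * (s + t * q)"
        unfolding s_def q_def by (simp add: field_simps power2_eq_square)
      then show ?thesis
        using that by (simp add: zero_le_mult_iff)
    qed
    have "((\<lambda>t. s + t * q) \<longlongrightarrow> s + 0 * q) (at_right 0)"
      by (intro tendsto_intros)
    moreover have "\<forall>\<^sub>F t in at_right 0. 0 \<le> s + t * q"
      using eventually_at_right_real[OF zero_less_one] by (rule eventually_mono) (auto intro: *)
    ultimately have "0 \<le> s"
      using tendsto_lowerbound[of "\<lambda>t. s + t * q" s] by auto
    \<comment> \<open>The required inner product is \<open>s\<close> plus the dual minimum, and both
      are nonnegative.\<close>
    moreover have "inner (v + (1/2) *\<^sub>R C) (y - (1/2) *\<^sub>R C) = s + ((norm C)\<^sup>2 / 4 + D)"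
      unfolding s_def c_def d_def power2_norm_eq_inner
      by (simp add: inner_add_left inner_add_right inner_diff_left inner_diff_right
          inner_commute field_simps)
    ultimately show "inner (v + (1/2) *\<^sub>R C) (y - (1/2) *\<^sub>R C) \<ge> 0"
      using nonneg[OF CD] by simp
  qed
qed (use that in auto)

text \<open>Otherwise adding \<open>(x, u)\<close> to the graph would give a proper monotone
  extension.\<close>

lemma maximally_monotone_memI:
  assumes "maximally_monotone A" and "\<And>y v. v \<in> A y \<Longrightarrow> inner (v - u) (y - x) \<ge> 0"
  shows "u \<in> A x"
proof (rule ccontr)
  assume "u \<notin> A x"
  define G where "G = A(x := insert u (A x))"
  have sub: "graph_op A \<subset> graph_op G"
    using \<open>u \<notin> A x\<close> by (auto simp: graph_op_def G_def)
  have "inner (u - v) (x - y) \<ge> 0" if "v \<in> A y" for y v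
    using assms(2)[OF that] by (simp add: inner_diff_left inner_diff_right)
  then have "monotone_op G"
    using assms unfolding maximally_monotone_def monotone_op_def G_def by auto
  with sub assms(1) show False
    unfolding maximally_monotone_def by blast
qed

lemma maximally_monotoneD:
  "maximally_monotone A \<Longrightarrow> u \<in> A x \<Longrightarrow> v \<in> A y \<Longrightarrow> inner (u - v) (x - y) \<ge> 0"
  unfolding maximally_monotone_def monotone_op_def by blast

text \<open>Debrunner-Flor, applied to the graph of \<open>(A - w) / c\<close>, gives a variational
  inequality that maximality turns into membership. General \<open>w\<close> and \<open>c\<close>
  serve both the regularised zero (\<open>w = 0\<close>, \<open>c = \<epsilon>\<close>) and the
  resolvent.\<close>

theorem minty:
  fixes A :: "'a::{real_inner, complete_space} \<Rightarrow> 'a set"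
  assumes A: "maximally_monotone A" and "c > 0"
  obtains x where "w - c *\<^sub>R x \<in> A x"
proof -
  define G where "G = {(y, (1/c) *\<^sub>R (v - w)) | y v. v \<in> A y}"
  have "inner (p - p') (y - y') \<ge> 0" if "(y, p) \<in> G" "(y', p') \<in> G" for y p y' p'
  proof -
    obtain v v' where v: "v \<in> A y" "v' \<in> A y'"
      and p: "p = (1/c) *\<^sub>R (v - w)" "p' = (1/c) *\<^sub>R (v' - w)"
      using \<open>(y, p) \<in> G\<close> \<open>(y', p') \<in> G\<close> by (auto simp: G_def)
    have "p - p' = (1/c) *\<^sub>R (v - v')"
      by (simp add: p algebra_simps)
    then show ?thesis
      using maximally_monotoneD[OF A v] \<open>c > 0\<close> by simp
  qed
  then obtain x where x: "\<And>y p. (y, p) \<in> G \<Longrightarrow> inner (p + x) (y - x) \<ge> 0"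
    using debrunner_flor[of G] by blast
  have "w - c *\<^sub>R x \<in> A x"
  proof (rule maximally_monotone_memI[OF A])
    fix y v assume "v \<in> A y"
    then have "0 \<le> c * inner ((1/c) *\<^sub>R (v - w) + x) (y - x)"
      using x \<open>c > 0\<close> by (auto simp: G_def)
    also have "\<dots> = inner (c *\<^sub>R ((1/c) *\<^sub>R (v - w) + x)) (y - x)"
      by simp
    also have "c *\<^sub>R ((1/c) *\<^sub>R (v - w) + x) = v - (w - c *\<^sub>R x)"
      using \<open>c > 0\<close> by (simp add: scaleR_add_right)
    finally show "inner (v - (w - c *\<^sub>R x)) (y - x) \<ge> 0" .
  qed
  then show ?thesis by (rule that)
qed

section \<open>The zero set and its minimal norm element\<close>

text \<open>This form shows that the zero set is closed and convex, as the existence of a minimal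
  norm element requires.\<close>

lemma zeros_op_eq_halfspaces:
  assumes "maximally_monotone A"
  shows "zeros_op A = (\<Inter>(y, v)\<in>graph_op A. {x. inner v x \<le> inner v y})"
proof safe
  fix x y v assume "x \<in> zeros_op A" "(y, v) \<in> graph_op A"
  then show "inner v x \<le> inner v y"
    using maximally_monotoneD[OF assms, of v y 0 x]
    by (auto simp: zeros_op_def graph_op_def inner_diff_right)
next
  fix x assume *: "x \<in> (\<Inter>(y, v)\<in>graph_op A. {x. inner v x \<le> inner v y})"
  have "0 \<in> A x"
    by (rule maximally_monotone_memI[OF assms])
      (use * in \<open>auto simp: graph_op_def inner_diff_right\<close>)
  then show "x \<in> zeros_op A"
    by (simp add: zeros_op_def)
qed

text \<open>\<open>ARG_MIN\<close> is a choice, so membership rests on the existence of a minimiser.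
  It comes from the quadratic minimisation with second component fixed at 0.\<close>

lemma min_norm_element:
  fixes S :: "'a::{real_inner, complete_space} set"
  assumes "closed S" "convex S" "S \<noteq> {}"
  shows "min_norm_element S \<in> S"
proof -
  obtain C where C: "C \<in> S" and le: "\<And>c. c \<in> S \<Longrightarrow> (norm C)\<^sup>2 / 4 \<le> (norm c)\<^sup>2 / 4"
  proof (rule quadratic_attains_inf[of "S \<times> {0}" 0])
    show "closed (S \<times> {0::real})" "convex (S \<times> {0::real})"
      using assms by (auto intro: closed_Times convex_Times)
  qed (use assms in auto)
  have "is_arg_min norm (\<lambda>x. x \<in> S) C"
    using C le by (auto simp: is_arg_min_linorder)
  then have "is_arg_min norm (\<lambda>x. x \<in> S) (min_norm_element S)"
    unfolding min_norm_element_def arg_min_def by (rule someI)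
  then show ?thesis
    by (simp add: is_arg_min_def)
qed

section \<open>The resolvent of the regularised operator\<close>

lemma mem_inverse_regularized_op:
  assumes "\<gamma> > 0"
  shows "z \<in> inverse_op (plus_op id_op (scale_op \<gamma> (regularized_op \<epsilon> A))) x \<longleftrightarrow>
    (1/\<gamma>) *\<^sub>R (x - z) - \<epsilon> *\<^sub>R z \<in> A z"
proof -
  have "x = z + \<gamma> *\<^sub>R (u + \<epsilon> *\<^sub>R z) \<longleftrightarrow> (1/\<gamma>) *\<^sub>R (x - z) - \<epsilon> *\<^sub>R z = u" for u
  proof
    assume "x = z + \<gamma> *\<^sub>R (u + \<epsilon> *\<^sub>R z)"
    then show "(1/\<gamma>) *\<^sub>R (x - z) - \<epsilon> *\<^sub>R z = u" using assms by simp
  next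
    assume "(1/\<gamma>) *\<^sub>R (x - z) - \<epsilon> *\<^sub>R z = u"
    then have "u + \<epsilon> *\<^sub>R z = (1/\<gamma>) *\<^sub>R (x - z)" by auto
    then show "x = z + \<gamma> *\<^sub>R (u + \<epsilon> *\<^sub>R z)" using assms by simp
  qed
  moreover have "z \<in> inverse_op (plus_op id_op (scale_op \<gamma> (regularized_op \<epsilon> A))) x \<longleftrightarrow>
      (\<exists>u\<in>A z. x = z + \<gamma> *\<^sub>R (u + \<epsilon> *\<^sub>R z))"
    by (auto simp: inverse_op_def plus_op_def id_op_def scale_op_def regularized_op_def)
  ultimately show ?thesis by auto
qed

text \<open>Monotonicity, multiplied by \<open>\<gamma>\<close>, bounds
  \<open>(1 + \<gamma> * \<epsilon>) * (norm (z - z'))\<^sup>2\<close> by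
  \<open>inner (x - x') (z - z')\<close>; Cauchy-Schwarz finishes. Working with inclusions rather
  than \<open>resolvent\<close> lets the same estimate prove uniqueness of the resolvent
  value.\<close>

lemma regularized_resolvent_contraction:
  assumes A: "maximally_monotone A" and "\<gamma> > 0"
    and z: "(1/\<gamma>) *\<^sub>R (x - z) - \<epsilon> *\<^sub>R z \<in> A z"
    and z': "(1/\<gamma>) *\<^sub>R (x' - z') - \<epsilon> *\<^sub>R z' \<in> A z'"
  shows "(1 + \<gamma> * \<epsilon>) * norm (z - z') \<le> norm (x - x')"
proof (cases "z = z'")
  case False
  let ?u = "(1/\<gamma>) *\<^sub>R (x - z) - \<epsilon> *\<^sub>R z" and ?u' = "(1/\<gamma>) *\<^sub>R (x' - z') - \<epsilon> *\<^sub>R z'"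
  have "0 \<le> \<gamma> * inner (?u - ?u') (z - z')"
    using maximally_monotoneD[OF A z z'] \<open>\<gamma> > 0\<close> by simp
  also have "\<dots> = inner (\<gamma> *\<^sub>R (?u - ?u')) (z - z')"
    by simp
  also have "\<gamma> *\<^sub>R (?u - ?u') = (x - x') - (1 + \<gamma> * \<epsilon>) *\<^sub>R (z - z')"
    using \<open>\<gamma> > 0\<close> by (simp add: algebra_simps)
  finally have "(1 + \<gamma> * \<epsilon>) * (norm (z - z'))\<^sup>2 \<le> inner (x - x') (z - z')"
    unfolding inner_diff_left[of "x - x'"] power2_norm_eq_inner by simp
  also have "\<dots> \<le> norm (x - x') * norm (z - z')"
    by (rule norm_cauchy_schwarz)
  finally show ?thesis
    using False by (simp add: power2_eq_square mult.assoc[symmetric])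
qed simp

lemma resolvent_regularized_op_eq:
  assumes A: "maximally_monotone A" and "\<gamma> > 0" "\<epsilon> > 0"
    and z: "(1/\<gamma>) *\<^sub>R (x - z) - \<epsilon> *\<^sub>R z \<in> A z"
  shows "resolvent (scale_op \<gamma> (regularized_op \<epsilon> A)) x = z"
  unfolding resolvent_def mem_inverse_regularized_op[OF \<open>\<gamma> > 0\<close>]
proof (rule the_equality)
  show "(1/\<gamma>) *\<^sub>R (x - z) - \<epsilon> *\<^sub>R z \<in> A z" by (rule z)
next
  fix z' assume "(1/\<gamma>) *\<^sub>R (x - z') - \<epsilon> *\<^sub>R z' \<in> A z'"
  from regularized_resolvent_contraction[OF A \<open>\<gamma> > 0\<close> this z]
  have "(1 + \<gamma> * \<epsilon>) * norm (z' - z) \<le> 0" by simp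
  moreover have "1 + \<gamma> * \<epsilon> > 0"
    using assms by (simp add: add_pos_pos)
  ultimately show "z' = z"
    by (simp add: mult_le_0_iff)
qed

lemma resolvent_regularized_op:
  fixes A :: "'a::{real_inner, complete_space} \<Rightarrow> 'a set"
  assumes A: "maximally_monotone A" and "\<gamma> > 0" "\<epsilon> > 0"
    and J: "J = resolvent (scale_op \<gamma> (regularized_op \<epsilon> A))"
  shows "(1/\<gamma>) *\<^sub>R (x - J x) - \<epsilon> *\<^sub>R J x \<in> A (J x)"
proof -
  \<comment> \<open>Collecting the multiples of \<open>z\<close> in the resolvent inclusion leaves
    Minty's theorem with \<open>c = 1/\<gamma> + \<epsilon>\<close>.\<close>
  obtain z where "(1/\<gamma>) *\<^sub>R x - (1/\<gamma> + \<epsilon>) *\<^sub>R z \<in> A z"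
    using minty[OF A] assms(2,3) by (metis add_pos_pos zero_less_divide_1_iff)
  then have "(1/\<gamma>) *\<^sub>R (x - z) - \<epsilon> *\<^sub>R z \<in> A z"
    by (simp add: algebra_simps)
  with resolvent_regularized_op_eq[OF A assms(2,3) this] show ?thesis
    by (simp add: J)
qed

section \<open>Error accumulation, and the distance from \<open>p\<close> to the zeros\<close>

lemma inexact_ppa_error_bound:
  fixes A :: "'a::{real_inner, complete_space} \<Rightarrow> 'a set"
  assumes A: "maximally_monotone A" and "\<gamma> > 0" "\<epsilon> > 0"
    and ppa: "inexact_ppa A \<gamma> \<epsilon> \<delta> x y"
    and p: "- \<epsilon> *\<^sub>R p \<in> A p"
  shows "norm (x k - p) \<le> (1 / (1 + \<gamma> * \<epsilon>)) ^ k * norm (x 0 - p) + \<delta> * (1 + inverse \<gamma> * inverse \<epsilon>)"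
proof -
  define J where "J = resolvent (scale_op \<gamma> (regularized_op \<epsilon> A))"
  define q where "q = 1 / (1 + \<gamma> * \<epsilon>)"
  define M where "M = \<delta> * (1 + inverse \<gamma> * inverse \<epsilon>)"
  have pos: "1 + \<gamma> * \<epsilon> > 0"
    using assms(2,3) by (simp add: add_pos_pos)
  have "0 \<le> norm (y (Suc 0))" by simp
  also have "\<dots> \<le> \<delta>"
    using ppa by (simp add: inexact_ppa_def)
  finally have "M \<ge> 0"
    using assms(2,3) by (simp add: M_def)
  \<comment> \<open>\<open>M\<close> is the fixed point of the error recursion
    \<open>t \<mapsto> q * t + \<delta>\<close>, so the induction carries it along
    unchanged.\<close>
  have M: "q * M + \<delta> = M"
  proof -
    have "M = \<delta> * ((1 + \<gamma> * \<epsilon>) / (\<gamma> * \<epsilon>))"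
      using assms(2,3) by (simp add: M_def field_simps)
    then have "q * M = \<delta> / (\<gamma> * \<epsilon>)"
      using pos by (simp add: q_def)
    then show ?thesis
      using assms(2,3) by (simp add: M_def field_simps)
  qed
  have step: "norm (x (Suc k) - p) \<le> q * norm (x k - p) + \<delta>" for k
  proof -
    \<comment> \<open>The resolvent fixes \<open>p\<close>: for \<open>x = z = p\<close> its
      inclusion reads \<open>- \<epsilon> *\<^sub>R p \<in> A p\<close>.\<close>
    have "(1 + \<gamma> * \<epsilon>) * norm (J (x k) - p) \<le> norm (x k - p)"
      using regularized_resolvent_contraction[OF A \<open>\<gamma> > 0\<close>
          resolvent_regularized_op[OF A assms(2,3) J_def], of p p] p by simp
    then have J: "norm (J (x k) - p) \<le> q * norm (x k - p)"
      using pos by (simp add: q_def field_simps)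
    have "norm (x (Suc k) - p) = norm ((J (x k) - p) + y (Suc k))" "norm (y (Suc k)) \<le> \<delta>"
      using ppa by (simp_all add: inexact_ppa_def J_def algebra_simps)
    then show ?thesis
      using norm_triangle_ineq[of "J (x k) - p" "y (Suc k)"] J by linarith
  qed
  have "norm (x k - p) \<le> q ^ k * norm (x 0 - p) + M"
  proof (induction k)
    case 0
    then show ?case using \<open>M \<ge> 0\<close> by simp
  next
    case (Suc k)
    have "norm (x (Suc k) - p) \<le> q * norm (x k - p) + \<delta>"
      by (rule step)
    also have "\<dots> \<le> q * (q ^ k * norm (x 0 - p) + M) + \<delta>"
      using Suc pos by (intro add_right_mono mult_left_mono) (auto simp: q_def)
    also have "\<dots> = q ^ Suc k * norm (x 0 - p) + M"
      using M by (simp add: algebra_simps)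
    finally show ?case .
  qed
  then show ?thesis
    by (simp add: q_def M_def)
qed

text \<open>If the regularised solution \<open>p\<close> has the same norm as the zero \<open>s\<close>, then \<open>p = s\<close>; this is what
  makes the open ball of radius \<open>\<sigma>\<close> suffice when \<open>\<epsilon> * norm s = \<sigma>\<close>.\<close>

lemma regularized_zero_norm:
  assumes A: "maximally_monotone A" and "\<epsilon> > 0" and p: "- \<epsilon> *\<^sub>R p \<in> A p" and s: "0 \<in> A s"
  shows "p = s \<or> norm p < norm s"
proof -
  have "0 \<le> \<epsilon> * (inner p s - inner p p)"
    using maximally_monotoneD[OF A p s] by (simp add: inner_diff_right algebra_simps)
  then have *: "inner p p \<le> inner p s"
    using \<open>\<epsilon> > 0\<close> by (simp add: zero_le_mult_iff)
  have "(norm (p - s))\<^sup>2 = inner s s + inner p p - 2 * inner p s"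
    by (simp add: power2_norm_eq_inner algebra_simps inner_commute)
  with * have "(norm (p - s))\<^sup>2 \<le> (norm s)\<^sup>2 - (norm p)\<^sup>2"
    by (simp add: power2_norm_eq_inner)
  moreover have "(norm (p - s))\<^sup>2 > 0" if "p \<noteq> s"
    using that by simp
  ultimately show ?thesis
    by (smt (verit) norm_ge_zero power2_less_imp_less)
qed

text \<open>If \<open>p = s\<close>, take \<open>r = s\<close>. Otherwise
  \<open>- \<epsilon> *\<^sub>R p\<close> has norm strictly below
  \<open>\<epsilon> * norm s\<close>, hence lies in the open ball, and R-continuity applies to
  \<open>p\<close> as one of its preimages.\<close>

lemma regularized_zero_near_zeros:
  assumes A: "maximally_monotone A" and "\<epsilon> > 0" and p: "- \<epsilon> *\<^sub>R p \<in> A p" and s: "0 \<in> A s"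
    and R: "R_continuous_radius \<sigma> (inverse_op A) 0 \<rho>" and rad: "ereal (\<epsilon> * norm s) \<le> \<sigma>"
  obtains r where "r \<in> zeros_op A" "norm (p - r) \<le> \<rho> (\<epsilon> * norm s)"
proof (cases "p = s")
  case True
  have "0 \<le> \<rho> (\<epsilon> * norm s)"
    using R \<open>\<epsilon> > 0\<close> by (simp add: R_continuous_radius_def modulus_function_def)
  with True s show ?thesis
    by (intro that[of s]) (auto simp: zeros_op_def)
next
  case False
  then have lt: "\<epsilon> * norm p < \<epsilon> * norm s"
    using regularized_zero_norm[OF assms(1-4)] \<open>\<epsilon> > 0\<close> by simp
  then have "ereal (\<epsilon> * norm p) < \<sigma>"
    using rad by (metis less_ereal.simps(1) less_le_trans)
  then have "ereal (norm (- \<epsilon> *\<^sub>R p - 0)) < \<sigma>"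
    using \<open>\<epsilon> > 0\<close> by simp
  moreover have "p \<in> inverse_op A (- \<epsilon> *\<^sub>R p)"
    using p by (simp add: inverse_op_def)
  ultimately obtain r where r: "r \<in> inverse_op A 0" "norm (p - r) \<le> \<rho> (norm (- \<epsilon> *\<^sub>R p - 0))"
    using R unfolding R_continuous_radius_def by blast
  have "mono_on {0..} \<rho>"
    using R by (simp add: R_continuous_radius_def modulus_function_def)
  then have "\<rho> (\<epsilon> * norm p) \<le> \<rho> (\<epsilon> * norm s)"
    using lt \<open>\<epsilon> > 0\<close> by (intro mono_onD[of "{0..}" \<rho>]) auto
  with r \<open>\<epsilon> > 0\<close> show ?thesis
    by (intro that[of r]) (auto simp: inverse_op_def zeros_op_def)
qed

section \<open>The asymptotic bound and its limit\<close>

text \<open>The triangle inequality through \<open>p\<close> splits the distance into the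
  accumulated error and the regularisation error. Only the geometric term depends on
  \<open>k\<close>, and it vanishes in the limit.\<close>

lemma limsup_infdist_inexact_ppa:
  fixes A :: "'a::{real_inner, complete_space} \<Rightarrow> 'a set"
  assumes A: "maximally_monotone A" and "\<gamma> > 0" "\<epsilon> > 0"
    and R: "R_continuous_radius \<sigma> (inverse_op A) 0 \<rho>"
    and s: "0 \<in> A s" and rad: "ereal (\<epsilon> * norm s) \<le> \<sigma>"
    and ppa: "inexact_ppa A \<gamma> \<epsilon> \<delta> x y"
  shows "limsup (\<lambda>k. ereal (infdist (x k) (zeros_op A)))
    \<le> ereal (\<delta> * (1 + inverse \<gamma> * inverse \<epsilon>) + \<rho> (\<epsilon> * norm s))"
proof -
  define q where "q = 1 / (1 + \<gamma> * \<epsilon>)"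
  define M where "M = \<delta> * (1 + inverse \<gamma> * inverse \<epsilon>)"
  obtain p where "0 - \<epsilon> *\<^sub>R p \<in> A p"
    using minty[OF A \<open>\<epsilon> > 0\<close>] .
  then have p: "- \<epsilon> *\<^sub>R p \<in> A p" by simp
  obtain r where r: "r \<in> zeros_op A" "norm (p - r) \<le> \<rho> (\<epsilon> * norm s)"
    using regularized_zero_near_zeros[OF A \<open>\<epsilon> > 0\<close> p s R rad] .
  have bound: "infdist (x k) (zeros_op A) \<le> q ^ k * norm (x 0 - p) + M + \<rho> (\<epsilon> * norm s)" for k
  proof -
    have "infdist (x k) (zeros_op A) \<le> dist (x k) r"
      by (rule infdist_le[OF r(1)])
    also have "\<dots> \<le> norm (x k - p) + norm (p - r)"
      using dist_triangle[of "x k" r p] by (simp add: dist_norm)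
    finally show ?thesis
      using inexact_ppa_error_bound[OF A assms(2,3) ppa p, of k] r(2) by (simp add: q_def M_def)
  qed
  have "0 \<le> q" "q < 1"
    using assms(2,3) by (auto simp: q_def add_pos_pos less_imp_le)
  then have "(\<lambda>k. q ^ k * norm (x 0 - p) + M + \<rho> (\<epsilon> * norm s)) \<longlonglongrightarrow> 0 * norm (x 0 - p) + M + \<rho> (\<epsilon> * norm s)"
    by (intro tendsto_intros LIMSEQ_realpow_zero)
  then have "(\<lambda>k. ereal (q ^ k * norm (x 0 - p) + M + \<rho> (\<epsilon> * norm s))) \<longlonglongrightarrow> ereal (M + \<rho> (\<epsilon> * norm s))"
    by simp
  then have "limsup (\<lambda>k. ereal (q ^ k * norm (x 0 - p) + M + \<rho> (\<epsilon> * norm s))) = ereal (M + \<rho> (\<epsilon> * norm s))"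
    by (intro lim_imp_Limsup) auto
  moreover have "limsup (\<lambda>k. ereal (infdist (x k) (zeros_op A)))
      \<le> limsup (\<lambda>k. ereal (q ^ k * norm (x 0 - p) + M + \<rho> (\<epsilon> * norm s)))"
    using bound by (intro Limsup_mono always_eventually) auto
  ultimately show ?thesis
    by (simp add: M_def)
qed

text \<open>For \<open>a > 0\<close> the argument tends to 0 from the right. For
  \<open>a = 0\<close> it is constantly 0, and \<open>\<rho> 0 = 0\<close> takes over.\<close>

lemma modulus_function_scaled_tendsto:
  assumes "modulus_function \<rho>" and "a \<ge> 0"
  shows "((\<lambda>\<epsilon>. \<rho> (\<epsilon> * a)) \<longlongrightarrow> 0) (at_right 0)"
proof (cases "a = 0")
  case True
  then show ?thesis
    using assms by (simp add: modulus_function_def)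
next
  case False
  have "((\<lambda>\<epsilon>. \<epsilon> * a) \<longlongrightarrow> 0 * a) (at_right 0)"
    by (intro tendsto_intros)
  moreover have "\<forall>\<^sub>F \<epsilon> in at_right 0. 0 < \<epsilon> * a"
    using eventually_at_right_less[of 0] by (rule eventually_mono) (use assms False in auto)
  ultimately have "filterlim (\<lambda>\<epsilon>. \<epsilon> * a) (at_right 0) (at_right 0)"
    by (intro tendsto_imp_filterlim_at_right) auto
  then show ?thesis
    using assms filterlim_compose[of \<rho> "nhds 0" "at_right 0"] by (auto simp: modulus_function_def)
qed

text \<open>The condition \<open>ereal (\<epsilon> * a) \<le> \<sigma>\<close> confines the estimate
  to the radius of R-continuity. As \<open>\<sigma> > 0\<close>, it holds for all small
  \<open>\<epsilon>\<close>, and for every \<open>\<epsilon>\<close> if \<open>\<sigma>\<close> is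
  infinite.\<close>

theorem theorem3:
  fixes A :: "'a::{real_inner, complete_space} \<Rightarrow> 'a set"
    and \<rho> :: "real \<Rightarrow> real" and \<sigma> :: ereal and \<gamma> a :: real and S :: "'a set"
  assumes "maximally_monotone A"
    and "S = zeros_op A" and "S \<noteq> {}"
    and "R_continuous_radius \<sigma> (inverse_op A) 0 \<rho>"
    and "\<gamma> > 0"
    and "a = norm (min_norm_element S)"
  shows "(\<forall>\<epsilon> \<delta> x y. \<epsilon> > 0 \<longrightarrow> \<delta> > 0 \<longrightarrow> ereal (\<epsilon> * a) \<le> \<sigma> \<longrightarrow> inexact_ppa A \<gamma> \<epsilon> \<delta> x y \<longrightarrow>
            limsup (\<lambda>k. ereal (infdist (x k) S))
              \<le> ereal (\<delta> * (1 + inverse \<gamma> * inverse \<epsilon>) + \<rho> (\<epsilon> * a))) \<and>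
         (\<forall>\<epsilon> x y. \<epsilon> > 0 \<longrightarrow> ereal (\<epsilon> * a) \<le> \<sigma> \<longrightarrow> inexact_ppa A \<gamma> \<epsilon> (\<epsilon>\<^sup>2) x y \<longrightarrow>
            limsup (\<lambda>k. ereal (infdist (x k) S))
              \<le> ereal (\<epsilon>\<^sup>2 + inverse \<gamma> * \<epsilon> + \<rho> (\<epsilon> * a))) \<and>
         ((\<lambda>\<epsilon>. \<epsilon>\<^sup>2 + inverse \<gamma> * \<epsilon> + \<rho> (\<epsilon> * a)) \<longlongrightarrow> 0) (at_right 0)"
proof (intro conjI allI impI)
  have "closed S" "convex S"
    unfolding \<open>S = zeros_op A\<close> zeros_op_eq_halfspaces[OF \<open>maximally_monotone A\<close>]
    by (auto intro!: closed_INT convex_INT closed_halfspace_le convex_halfspace_le)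
  then have "min_norm_element S \<in> S"
    using \<open>S \<noteq> {}\<close> by (rule min_norm_element)
  then have s: "0 \<in> A (min_norm_element S)"
    unfolding \<open>S = zeros_op A\<close> by (simp add: zeros_op_def)
  note bound = limsup_infdist_inexact_ppa[OF assms(1) \<open>\<gamma> > 0\<close> _ assms(4) s, folded assms(2,6)]
  {
    fix \<epsilon> \<delta> :: real and x y
    assume "\<epsilon> > 0" "ereal (\<epsilon> * a) \<le> \<sigma>" "inexact_ppa A \<gamma> \<epsilon> \<delta> x y"
    then show "limsup (\<lambda>k. ereal (infdist (x k) S))
        \<le> ereal (\<delta> * (1 + inverse \<gamma> * inverse \<epsilon>) + \<rho> (\<epsilon> * a))"
      by (rule bound)
  }
  {
    fix \<epsilon> :: real and x y
    assume *: "\<epsilon> > 0" "ereal (\<epsilon> * a) \<le> \<sigma>" "inexact_ppa A \<gamma> \<epsilon> (\<epsilon>\<^sup>2) x y"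
    have "\<epsilon>\<^sup>2 * (1 + inverse \<gamma> * inverse \<epsilon>) = \<epsilon>\<^sup>2 + inverse \<gamma> * \<epsilon>"
      using \<open>\<epsilon> > 0\<close> \<open>\<gamma> > 0\<close> by (simp add: field_simps power2_eq_square)
    with bound[OF *] show "limsup (\<lambda>k. ereal (infdist (x k) S))
        \<le> ereal (\<epsilon>\<^sup>2 + inverse \<gamma> * \<epsilon> + \<rho> (\<epsilon> * a))"
      by simp
  }
  have "((\<lambda>\<epsilon>. \<rho> (\<epsilon> * a)) \<longlongrightarrow> 0) (at_right 0)"
    using assms(4,6) by (intro modulus_function_scaled_tendsto) (auto simp: R_continuous_radius_def)
  then have "((\<lambda>\<epsilon>. \<epsilon>\<^sup>2 + inverse \<gamma> * \<epsilon> + \<rho> (\<epsilon> * a)) \<longlongrightarrow> 0\<^sup>2 + inverse \<gamma> * 0 + 0) (at_right 0)"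
    by (intro tendsto_intros)
  then show "((\<lambda>\<epsilon>. \<epsilon>\<^sup>2 + inverse \<gamma> * \<epsilon> + \<rho> (\<epsilon> * a)) \<longlongrightarrow> 0) (at_right 0)"
    by simp
qed

end
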